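(* For $n,d,k\ge 2$, there exist positive constants $c_1$ and $c_2$ depending only on $k$ such that $$\frac{c_1 d^{\frac{k}{k-1}}}{\log d}\,\log\left(\frac{n^{k-1}}{d}\right)\ \le\ b(n,d,k)\ \le\ c_2\, d^{\frac{k}{k-1}}\log n$$ holds.
   Context: A $k$-graph $G$ is a $k$-uniform hypergraph (identified with its edge set) on a finite vertex set $V(G)$; its complement $\overline{G}$ is the $k$-graph on $V(G)$ whose edges are the $k$-subsets of $V(G)$ that are not edges of $G$. A set $I\subseteq V(G)$ is independent in $G$ if it contains no edge of $G$. $\vartheta(G)$ is the minimum $t$ such that there exist independent sets $I_1,\dots,I_t$ of $G$ with every edge of $\overline{G}$ contained in some $I_j$. For $S\subseteq V(G)$ let $\deg_G(S)=|\{e\in G: S\subseteq e\}|$, and let $\Delta_i(G)=\max\{\deg_G(S): S\subseteq V(G), |S|=i\}$. A $k$-graph $G$ is $d$-balanced if $\Delta_i(G)\le d^{\frac{k-i}{k-1}}$ for all $1\le i\le k$. Finally, $b(n,d,k)$ is the maximum of $\vartheta(G)$ over all $d$-balanced $k$-graphs $G$ on $n$ vertices. *)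

theory Defs
  imports Complex_Main "HOL-Library.Ramsey"
begin

text \<open>
  A \<open>k\<close>-graph is given by its vertex set \<open>V\<close> and its edge set \<open>E\<close>;
  \<open>nsets V k\<close> is the set of \<open>k\<close>-element subsets of \<open>V\<close>.
\<close>

definition kgraph :: "nat \<Rightarrow> 'a set \<Rightarrow> 'a set set \<Rightarrow> bool" where
  "kgraph k V E \<longleftrightarrow> finite V \<and> E \<subseteq> nsets V k"

definition complement_edges :: "nat \<Rightarrow> 'a set \<Rightarrow> 'a set set \<Rightarrow> 'a set set" where
  "complement_edges k V E = nsets V k - E"

definition independent_in :: "'a set \<Rightarrow> 'a set set \<Rightarrow> 'a set \<Rightarrow> bool" where
  "independent_in V E I \<longleftrightarrow> I \<subseteq> V \<and> (\<forall>e\<in>E. \<not> e \<subseteq> I)"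

text \<open>
  The number \<open>t\<close> of sets in a cover is taken to be positive. This matters only when the
  complement has no edges: then \<open>\<vartheta> = 1\<close>, where the empty family would give \<open>0\<close>.
  Such a \<open>t\<close> always exists, since every edge of the complement is itself an independent set.
\<close>

definition theta :: "nat \<Rightarrow> 'a set \<Rightarrow> 'a set set \<Rightarrow> nat" where
  "theta k V E = (LEAST t. t \<ge> 1 \<and>
     (\<exists>I :: nat \<Rightarrow> 'a set.
        (\<forall>j\<in>{1..t}. independent_in V E (I j)) \<and>
        (\<forall>e\<in>complement_edges k V E. \<exists>j\<in>{1..t}. e \<subseteq> I j)))"

definition deg :: "'a set set \<Rightarrow> 'a set \<Rightarrow> nat" where
  "deg E S = card {e\<in>E. S \<subseteq> e}"

text \<open>
  For \<open>i \<le> card V\<close> the supremum is a maximum over a finite nonempty set. For \<open>i > card V\<close>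
  there is no \<open>S\<close>, and the supremum of the empty set of natural numbers is \<open>0\<close>.
\<close>

definition max_deg :: "'a set \<Rightarrow> 'a set set \<Rightarrow> nat \<Rightarrow> nat" where
  "max_deg V E i = (SUP S\<in>nsets V i. deg E S)"

definition balanced :: "nat \<Rightarrow> real \<Rightarrow> 'a set \<Rightarrow> 'a set set \<Rightarrow> bool" where
  "balanced k d V E \<longleftrightarrow>
     (\<forall>i\<in>{1..k}. real (max_deg V E i) \<le> d powr ((real k - real i) / (real k - 1)))"

text \<open>
  Every finite graph has an isomorphic copy with vertices in \<open>nat\<close>. For \<open>d \<ge> 1\<close> the set of
  values is nonempty (the edgeless graph is \<open>d\<close>-balanced), and it is finite because \<open>\<vartheta>\<close> is
  at most \<open>max 1 (n choose k)\<close>.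
\<close>

definition b :: "nat \<Rightarrow> real \<Rightarrow> nat \<Rightarrow> nat" where
  "b n d k = Max {theta k V E | (V :: nat set) E.
                    kgraph k V E \<and> card V = n \<and> balanced k d V E}"

end

theory Submission
  imports Defs "HOL-Combinatorics.Permutations"
begin

text \<open>
  Write \<open>D = d^(1/(k-1))\<close>. Upper bound: keep every vertex independently with probability \<open>p\<close> of order
  \<open>1/D\<close> and delete the vertices of every edge that survives. Balance bounds the expected number of
  surviving edges that meet a fixed non-edge \<open>e\<close>, given that \<open>e\<close> survives, by \<open>1/2\<close>. So the
  result is an independent set containing \<open>e\<close> with probability at least \<open>p^k/2\<close>, and greedy choice
  covers all non-edges with \<open>O(D^k ln n)\<close> sets.

  Lower bound: take \<open>m\<close> of order \<open>D\<close> and \<open>k N\<close> disjoint cliques on \<open>m\<close> vertices each, placed in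
  \<open>k\<close> columns. Join them by \<open>m^k\<close> perfect matchings, one for each choice of a label in every
  column, each twisted by an arbitrary permutation of \<open>N\<close> points. All \<open>(N!)^(m^k)\<close> graphs obtained
  are balanced, and their independent sets have at most \<open>k (k - 1) N\<close> vertices because of the
  cliques. A graph is determined by a cover of its non-edges by independent sets, so comparing
  the number of graphs with the number of families of \<open>t\<close> such small sets bounds \<open>t\<close> from below.
\<close>

subsection \<open>Degrees and balance\<close>

lemma deg_le_max_deg:
  assumes "finite V" "S \<in> nsets V i"
  shows "deg E S \<le> max_deg V E i"
  unfolding max_deg_def using assms
  by (intro cSUP_upper bdd_above_finite finite_imageI finite_imp_finite_nsets) auto

lemma max_deg_le:
  assumes "\<And>S. S \<in> nsets V i \<Longrightarrow> real (deg E S) \<le> r" "0 \<le> r" "finite V"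
  shows "real (max_deg V E i) \<le> r"
proof (cases "nsets V i = {}")
  case True
  then show ?thesis using assms by (simp add: max_deg_def)
next
  case False
  have fin: "finite (deg E ` nsets V i)"
    using assms(3) by (simp add: finite_imp_finite_nsets)
  have "max_deg V E i \<in> deg E ` nsets V i"
    unfolding max_deg_def using False fin by (subst cSup_eq_Max) (auto intro: Max_in)
  then show ?thesis using assms by auto
qed

text \<open>Setting \<open>d = D ^ (k - 1)\<close> turns the real exponents of the balance condition
  into the natural exponents \<open>k - i\<close>. The estimates below are therefore stated in terms
  of \<open>D\<close>.\<close>

lemma powr_power_quotient:
  assumes "0 < D" "2 \<le> k" "i \<le> k"
  shows "((D::real) ^ (k - 1)) powr ((real k - real i) / (real k - 1)) = D ^ (k - i)"
proof -
  have "(D ^ (k - 1)) powr ((real k - real i) / (real k - 1))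
      = (D powr real (k - 1)) powr ((real k - real i) / (real k - 1))"
    by (simp only: powr_realpow[OF assms(1)])
  also have "\<dots> = D powr (real k - real i)"
    using assms by (simp add: powr_powr of_nat_diff)
  also have "\<dots> = D powr real (k - i)"
    using assms by (simp add: of_nat_diff)
  also have "\<dots> = D ^ (k - i)" by (simp only: powr_realpow[OF assms(1)])
  finally show ?thesis .
qed

lemma balanced_power_iff:
  assumes "0 < D" "2 \<le> k" "finite V"
  shows "balanced k (D ^ (k - 1)) V E
    \<longleftrightarrow> (\<forall>i\<in>{1..k}. \<forall>S\<in>nsets V i. real (deg E S) \<le> D ^ (k - i))"
proof -
  have "real (max_deg V E i) \<le> (D ^ (k - 1)) powr ((real k - real i) / (real k - 1))
      \<longleftrightarrow> (\<forall>S\<in>nsets V i. real (deg E S) \<le> D ^ (k - i))" if "i \<in> {1..k}" for i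
  proof -
    have "i \<le> k" using that by simp
    have "real (deg E S) \<le> D ^ (k - i)"
      if "real (max_deg V E i) \<le> D ^ (k - i)" "S \<in> nsets V i" for S
      using deg_le_max_deg[OF assms(3) that(2), of E] that(1) by linarith
    then show ?thesis unfolding powr_power_quotient[OF assms(1,2) \<open>i \<le> k\<close>]
      using max_deg_le[OF _ _ assms(3), of i E "D ^ (k - i)"] assms(1) by fastforce
  qed
  then show ?thesis unfolding balanced_def by blast
qed

text \<open>A \<open>k\<close>-set inside another \<open>k\<close>-set equals it. This settles
  \<open>i = k\<close> in the balance condition, where the bound is
  \<open>D ^ 0 = 1\<close>.\<close>

lemma deg_full_le_1:
  assumes "E \<subseteq> nsets V k" "S \<in> nsets V k"
  shows "deg E S \<le> 1"
proof -
  have "S = e" if "e \<in> E" "S \<subseteq> e" for e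
    using that assms by (intro card_subset_eq) (auto simp: nsets_def)
  then have "{e \<in> E. S \<subseteq> e} \<subseteq> {S}" by auto
  then have "card {e \<in> E. S \<subseteq> e} \<le> card {S}" by (intro card_mono) auto
  then show ?thesis by (simp add: deg_def)
qed

subsection \<open>Covers\<close>

definition cover :: "nat \<Rightarrow> 'a set \<Rightarrow> 'a set set \<Rightarrow> nat \<Rightarrow> (nat \<Rightarrow> 'a set) \<Rightarrow> bool" where
  "cover k V E t I \<longleftrightarrow> (\<forall>j\<in>{1..t}. independent_in V E (I j)) \<and>
     (\<forall>e\<in>complement_edges k V E. \<exists>j\<in>{1..t}. e \<subseteq> I j)"

lemma theta_eq_Least_cover: "theta k V E = (LEAST t. 1 \<le> t \<and> (\<exists>I. cover k V E t I))"
  by (simp add: theta_def cover_def)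

lemma theta_le:
  assumes "1 \<le> t" "cover k V E t I"
  shows "theta k V E \<le> t"
  unfolding theta_eq_Least_cover using assms by (intro Least_le) auto

lemma finite_complement_edges: "finite V \<Longrightarrow> finite (complement_edges k V E)"
  by (simp add: complement_edges_def finite_imp_finite_nsets)

text \<open>A \<open>k\<close>-set that is not an edge contains no edge, so the non-edges themselves
  form a cover. Hence the \<open>LEAST\<close> that defines \<open>theta\<close> is
  attained.\<close>

lemma theta_cover:
  assumes "kgraph k V E" "1 \<le> k"
  obtains I where "1 \<le> theta k V E" "cover k V E (theta k V E) I"
proof -
  let ?c = "card (complement_edges k V E)"
  have "finite (complement_edges k V E)"
    using assms by (intro finite_complement_edges) (simp add: kgraph_def)
  then obtain h where h: "bij_betw h {1..?c} (complement_edges k V E)"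
    using ex_bij_betw_nat_finite_1 by blast
  \<comment> \<open>Index 1 must be served even if there are no non-edges; the default
    \<open>{}\<close> does this. It is independent because \<open>1 \<le> k\<close> rules out an
    empty edge.\<close>
  define I where "I = (\<lambda>j. if j \<in> {1..?c} then h j else {})"
  have "independent_in V E e" if "e \<in> complement_edges k V E" for e
  proof -
    have "f = e" if "f \<in> E" "f \<subseteq> e" for f
      using that \<open>e \<in> _\<close> assms
      by (intro card_subset_eq) (auto simp: complement_edges_def kgraph_def nsets_def)
    then show ?thesis
      using that by (auto simp: independent_in_def complement_edges_def nsets_def)
  qed
  moreover have "independent_in V E {}"
    using assms by (auto simp: independent_in_def kgraph_def nsets_def)
  ultimately have "independent_in V E (I j)" for j
    using bij_betwE[OF h] by (simp add: I_def)
  moreover have "\<exists>j\<in>{1..max 1 ?c}. e \<subseteq> I j" if e: "e \<in> complement_edges k V E" for e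
  proof -
    obtain j where "j \<in> {1..?c}" "h j = e"
      using h e by (metis bij_betw_imp_surj_on imageE)
    then show ?thesis by (intro bexI[of _ j]) (auto simp: I_def)
  qed
  ultimately have "cover k V E (max 1 ?c) I" by (simp add: cover_def)
  then have "\<exists>t. t \<ge> 1 \<and> (\<exists>I. cover k V E t I)"
    by (intro exI[of _ "max 1 ?c"] conjI exI[of _ I]) auto
  from LeastI_ex[OF this] obtain I where "1 \<le> theta k V E" "cover k V E (theta k V E) I"
    unfolding theta_eq_Least_cover by (elim conjE exE)
  then show thesis by (rule that)
qed

text \<open>Preimages under the injection \<open>h\<close> of independent sets are independent, and
  \<open>h\<close> maps non-edges to non-edges, so a cover can be pulled back. Vertices of
  \<open>W\<close> outside the image are allowed: adding isolated vertices never decreases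
  \<open>theta\<close>.\<close>

lemma theta_embed:
  assumes "kgraph k W ((`) h ` E)" "1 \<le> k" "inj_on h V" "h ` V \<subseteq> W" "E \<subseteq> nsets V k"
  shows "theta k V E \<le> theta k W ((`) h ` E)"
proof -
  obtain J where J: "1 \<le> theta k W ((`) h ` E)" "cover k W ((`) h ` E) (theta k W ((`) h ` E)) J"
    using theta_cover assms(1,2) by blast
  have "cover k V E (theta k W ((`) h ` E)) (\<lambda>j. {v \<in> V. h v \<in> J j})"
    unfolding cover_def
  proof (intro conjI ballI)
    fix j assume "j \<in> {1..theta k W ((`) h ` E)}"
    then have "independent_in W ((`) h ` E) (J j)" using J by (simp add: cover_def)
    then show "independent_in V E {v \<in> V. h v \<in> J j}"
      by (auto simp: independent_in_def)
  next
    fix e assume e: "e \<in> complement_edges k V E"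
    then have "e \<subseteq> V" "finite e" "card e = k" "e \<notin> E"
      by (auto simp: complement_edges_def nsets_def)
    have "h ` e \<notin> (`) h ` E"
    proof
      assume "h ` e \<in> (`) h ` E"
      then obtain f where "f \<in> E" "h ` e = h ` f" by auto
      moreover have "f \<subseteq> V" using \<open>f \<in> E\<close> assms(5) by (auto simp: nsets_def)
      ultimately have "e = f"
        using assms(3) \<open>e \<subseteq> V\<close> by (simp add: inj_on_image_eq_iff)
      then show False using \<open>f \<in> E\<close> \<open>e \<notin> E\<close> by simp
    qed
    moreover have "card (h ` e) = k"
      using \<open>card e = k\<close> assms(3) \<open>e \<subseteq> V\<close> by (metis card_image inj_on_subset)
    ultimately have "h ` e \<in> complement_edges k W ((`) h ` E)"
      using \<open>e \<subseteq> V\<close> \<open>finite e\<close> assms(4) by (auto simp: complement_edges_def nsets_def)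
    then obtain j where "j \<in> {1..theta k W ((`) h ` E)}" "h ` e \<subseteq> J j"
      using J by (auto simp: cover_def)
    then show "\<exists>j\<in>{1..theta k W ((`) h ` E)}. e \<subseteq> {v \<in> V. h v \<in> J j}"
      using \<open>e \<subseteq> V\<close> by (intro bexI[of _ j]) auto
  qed
  then show ?thesis using J by (intro theta_le)
qed

text \<open>A cover determines its graph, since the edges are exactly the \<open>k\<close>-sets that
  lie in none of its sets. So the graphs in \<open>F\<close> inject into the sequences of
  \<open>t\<close> members of \<open>\<I>\<close>.\<close>

lemma card_le_independent_power:
  assumes "finite V" "1 \<le> k" "finite \<I>"
    and graph: "\<And>E. E \<in> F \<Longrightarrow> E \<subseteq> nsets V k"
    and theta: "\<And>E. E \<in> F \<Longrightarrow> theta k V E \<le> t"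
    and ind: "\<And>E I. E \<in> F \<Longrightarrow> independent_in V E I \<Longrightarrow> I \<in> \<I>"
  shows "card F \<le> card \<I> ^ t"
proof -
  have "\<exists>I. I \<in> {1..t} \<rightarrow>\<^sub>E \<I> \<and> E = {e \<in> nsets V k. \<forall>j\<in>{1..t}. \<not> e \<subseteq> I j}" if E: "E \<in> F" for E
  proof -
    let ?\<theta> = "theta k V E"
    have "kgraph k V E" using graph[OF E] assms(1) by (simp add: kgraph_def)
    then obtain I where I: "1 \<le> ?\<theta>" "cover k V E ?\<theta> I"
      using theta_cover assms(2) by blast
    \<comment> \<open>A shorter cover is padded to length \<open>t\<close> by repeating
      \<open>I 1\<close>, which is available since \<open>theta\<close> is at least 1.\<close>
    define J where "J = restrict (\<lambda>j. if j \<le> ?\<theta> then I j else I 1) {1..t}"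
    have indJ: "independent_in V E (J j)" if "j \<in> {1..t}" for j
      using that I by (auto simp: J_def cover_def)
    have "J \<in> {1..t} \<rightarrow>\<^sub>E \<I>"
      using ind[OF E] indJ by (intro PiE_I) (auto simp: J_def)
    moreover have "\<exists>j\<in>{1..t}. e \<subseteq> J j" if e: "e \<in> nsets V k" "e \<notin> E" for e
    proof -
      obtain j where "j \<in> {1..?\<theta>}" "e \<subseteq> I j"
        using e I unfolding cover_def complement_edges_def by blast
      then show ?thesis
        using theta[OF E] by (intro bexI[of _ j]) (auto simp: J_def)
    qed
    moreover have "\<not> e \<subseteq> J j" if "e \<in> E" "j \<in> {1..t}" for e j
      using indJ that by (auto simp: independent_in_def)
    ultimately have "E = {e \<in> nsets V k. \<forall>j\<in>{1..t}. \<not> e \<subseteq> J j}"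
    proof (intro set_eqI iffI)
      fix e assume "e \<in> E"
      then show "e \<in> {e \<in> nsets V k. \<forall>j\<in>{1..t}. \<not> e \<subseteq> J j}"
        using graph[OF E] \<open>\<And>e j. e \<in> E \<Longrightarrow> j \<in> {1..t} \<Longrightarrow> \<not> e \<subseteq> J j\<close> by auto
    next
      fix e assume "e \<in> {e \<in> nsets V k. \<forall>j\<in>{1..t}. \<not> e \<subseteq> J j}"
      then show "e \<in> E"
        using \<open>\<And>e. e \<in> nsets V k \<Longrightarrow> e \<notin> E \<Longrightarrow> \<exists>j\<in>{1..t}. e \<subseteq> J j\<close> by blast
    qed
    with \<open>J \<in> _\<close> show ?thesis by (intro exI[of _ J] conjI)
  qed
  then have "\<forall>E\<in>F. \<exists>I. I \<in> {1..t} \<rightarrow>\<^sub>E \<I> \<and>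
      E = {e \<in> nsets V k. \<forall>j\<in>{1..t}. \<not> e \<subseteq> I j}"
    by (rule ballI)
  from bchoice[OF this] obtain \<Phi> where *: "\<forall>E\<in>F. \<Phi> E \<in> {1..t} \<rightarrow>\<^sub>E \<I> \<and>
      E = {e \<in> nsets V k. \<forall>j\<in>{1..t}. \<not> e \<subseteq> \<Phi> E j}" ..
  have \<Phi>: "\<Phi> E \<in> {1..t} \<rightarrow>\<^sub>E \<I>"
    "E = {e \<in> nsets V k. \<forall>j\<in>{1..t}. \<not> e \<subseteq> \<Phi> E j}" if "E \<in> F" for E
    by (rule bspec[OF * that, THEN conjunct1], rule bspec[OF * that, THEN conjunct2])
  have "inj_on \<Phi> F"
  proof (rule inj_onI)
    fix E E' assume E: "E \<in> F" "E' \<in> F" and eq: "\<Phi> E = \<Phi> E'"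
    have "E = {e \<in> nsets V k. \<forall>j\<in>{1..t}. \<not> e \<subseteq> \<Phi> E j}" by (rule \<Phi>(2)[OF E(1)])
    also have "\<dots> = E'" unfolding eq by (rule \<Phi>(2)[OF E(2), symmetric])
    finally show "E = E'" .
  qed
  then have "card F \<le> card ({1..t} \<rightarrow>\<^sub>E \<I>)"
    using \<Phi>(1) assms(3) by (intro card_inj_on_le[of \<Phi>]) (auto intro: finite_PiE)
  then show ?thesis using assms(3) by (simp add: card_PiE)
qed

subsection \<open>Upper bound\<close>

lemma sum_Pow_power:
  assumes "finite V"
  shows "(\<Sum>R\<in>Pow V. (x::real) ^ card R) = (1 + x) ^ card V"
  using prod_add[OF assms, of "\<lambda>_. x" "\<lambda>_. 1"] by (simp add: add.commute)

section \<open>Random vertex sets and their cores\<close>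

text \<open>The probability that a random subset of \<open>V\<close> equals \<open>R\<close> when
  every vertex is kept independently with probability \<open>p\<close>.\<close>

definition weight :: "real \<Rightarrow> 'a set \<Rightarrow> 'a set \<Rightarrow> real" where
  "weight p V R = p ^ card R * (1 - p) ^ card (V - R)"

lemma sum_weight_superset:
  assumes "finite V" "A \<subseteq> V"
  shows "(\<Sum>R\<in>{R\<in>Pow V. A \<subseteq> R}. weight p V R) = p ^ card A"
proof -
  have "p ^ card A = (\<Prod>v\<in>V. if v \<in> A then p else 1)"
    using assms by (simp add: prod.If_cases Int_absorb1)
  \<comment> \<open>In each factor the first summand stands for keeping \<open>v\<close> and the
    second for dropping it. Dropping costs a factor 0 on \<open>A\<close>, so after expansion only
    the sets \<open>R\<close> containing \<open>A\<close> remain.\<close>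
  also have "\<dots> = (\<Prod>v\<in>V. p + (if v \<in> A then 0 else 1 - p))"
    by (intro prod.cong) auto
  also have "\<dots> = (\<Sum>R\<in>Pow V. (\<Prod>v\<in>R. p) * (\<Prod>v\<in>V - R. if v \<in> A then 0 else 1 - p))"
    using assms by (intro prod_add)
  also have "\<dots> = (\<Sum>R\<in>Pow V. if A \<subseteq> R then weight p V R else 0)"
  proof (intro sum.cong refl)
    fix R assume R: "R \<in> Pow V"
    show "(\<Prod>v\<in>R. p) * (\<Prod>v\<in>V - R. if v \<in> A then 0 else 1 - p)
      = (if A \<subseteq> R then weight p V R else 0)"
    proof (cases "A \<subseteq> R")
      case True
      then have "(\<Prod>v\<in>V - R. if v \<in> A then 0 else 1 - p) = (\<Prod>v\<in>V - R. 1 - p)"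
        by (intro prod.cong) auto
      then show ?thesis using True by (simp add: weight_def)
    next
      case False
      then obtain v where "v \<in> A" "v \<notin> R" by auto
      then have "(\<Prod>v\<in>V - R. if v \<in> A then 0 else 1 - p) = 0"
        using assms by (intro prod_zero) auto
      then show ?thesis using False by simp
    qed
  qed
  also have "\<dots> = (\<Sum>R\<in>{R\<in>Pow V. A \<subseteq> R}. weight p V R)"
    using assms by (intro sum.inter_filter[symmetric]) auto
  finally show ?thesis by simp
qed


text \<open>All vertices of an edge inside \<open>R\<close> are deleted, not just one. So a set
  \<open>e \<subseteq> R\<close> fails to lie in the core exactly when some edge inside
  \<open>R\<close> meets it.\<close>

definition core :: "'a set set \<Rightarrow> 'a set \<Rightarrow> 'a set" where
  "core E R = {v \<in> R. \<forall>f\<in>E. f \<subseteq> R \<longrightarrow> v \<notin> f}"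

lemma independent_core:
  assumes "R \<subseteq> V" "{} \<notin> E"
  shows "independent_in V E (core E R)"
  unfolding independent_in_def
proof (intro conjI ballI notI)
  show "core E R \<subseteq> V" using assms by (auto simp: core_def)
  fix f assume f: "f \<in> E" "f \<subseteq> core E R"
  then have "f \<subseteq> R" by (auto simp: core_def)
  moreover obtain v where "v \<in> f" using f(1) assms(2) by fastforce
  ultimately show False using f by (auto simp: core_def)
qed

lemma one_le_scaled: "1 \<le> D \<Longrightarrow> 1 \<le> 2 ^ n * (D::real)"
  using mult_mono[of 1 "2 ^ n" 1 D] by simp

lemma sum_UNION_le:
  fixes g :: "'b \<Rightarrow> real"
  assumes "finite A" "\<And>a. a \<in> A \<Longrightarrow> finite (B a)" "\<And>x. 0 \<le> g x"
  shows "sum g (\<Union>a\<in>A. B a) \<le> (\<Sum>a\<in>A. sum g (B a))"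
  using assms(1,2)
proof (induction A)
  case (insert a A)
  have "sum g (B a \<union> (\<Union>a\<in>A. B a)) \<le> sum g (B a) + sum g (\<Union>a\<in>A. B a)"
    using insert assms(3) sum.union_inter[of "B a" "\<Union>a\<in>A. B a" g]
      sum_nonneg[of "B a \<inter> (\<Union>a\<in>A. B a)" g] by simp
  also have "\<dots> \<le> (\<Sum>a\<in>insert a A. sum g (B a))" using insert by simp
  finally show ?case by simp
qed simp

text \<open>The edges are grouped by \<open>S = f \<inter> e\<close>. There are at most
  \<open>D ^ (k - card S)\<close> edges for each \<open>S\<close>, and
  \<open>card (e \<union> f) = 2 k - card S\<close>, so a group contributes at most
  \<open>p ^ k * (D * p) ^ (k - card S)\<close>. The value of \<open>p\<close> makes this at most
  \<open>p ^ k / 2 ^ (k + 1)\<close>, and there are at most \<open>2 ^ k\<close> groups.\<close>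

lemma sum_edges_meeting_le:
  assumes "finite V" "2 \<le> k" "1 \<le> D" "E \<subseteq> nsets V k" "balanced k (D ^ (k - 1)) V E"
    and e: "e \<in> nsets V k" "e \<notin> E"
    and p: "p = 1 / (2 ^ (k + 1) * D)"
  shows "(\<Sum>f | f \<in> E \<and> f \<inter> e \<noteq> {}. p ^ card (e \<union> f)) \<le> p ^ k / 2"
proof -
  have "finite E" using assms by (meson finite_subset finite_imp_finite_nsets)
  have fe: "finite e" "card e = k" "e \<subseteq> V" using e by (auto simp: nsets_def)
  have p01: "0 < p" "D * p = 1 / 2 ^ (k + 1)" using assms by auto
  let ?P = "Pow e - {{}, e}"
  have "(\<Sum>f | f \<in> E \<and> f \<inter> e \<noteq> {}. p ^ card (e \<union> f))
      \<le> (\<Sum>f\<in>(\<Union>S\<in>?P. {f \<in> E. f \<inter> e = S}). p ^ card (e \<union> f))"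
  proof (intro sum_mono2)
    show "finite (\<Union>S\<in>?P. {f \<in> E. f \<inter> e = S})" using \<open>finite E\<close> fe by auto
    \<comment> \<open>The group \<open>S = e\<close> is empty because \<open>e\<close> is not an
      edge; this keeps the exponent \<open>k - card S\<close> positive.\<close>
    have "f \<inter> e \<noteq> e" if "f \<in> E" for f
    proof
      assume "f \<inter> e = e"
      moreover have "finite f" "card f = k" using that assms by (auto simp: nsets_def)
      ultimately have "e = f" using fe by (intro card_subset_eq) auto
      then show False using that e by simp
    qed
    then show "{f. f \<in> E \<and> f \<inter> e \<noteq> {}} \<subseteq> (\<Union>S\<in>?P. {f \<in> E. f \<inter> e = S})" by auto
  qed (use p01 in auto)
  also have "\<dots> = (\<Sum>S\<in>?P. \<Sum>f\<in>{f \<in> E. f \<inter> e = S}. p ^ card (e \<union> f))"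
    using \<open>finite E\<close> fe by (intro sum.UNION_disjoint) auto
  also have "\<dots> \<le> (\<Sum>S\<in>?P. p ^ k / 2 ^ (k + 1))"
  proof (intro sum_mono)
    fix S assume S: "S \<in> ?P"
    then have "S \<subseteq> e" "S \<noteq> {}" "S \<noteq> e" by auto
    have "finite S" using S fe finite_subset by auto
    have "card S < k" using \<open>S \<subseteq> e\<close> \<open>S \<noteq> e\<close> fe psubset_card_mono by blast
    have "1 \<le> card S" using \<open>finite S\<close> \<open>S \<noteq> {}\<close> by (simp add: Suc_le_eq card_gt_0_iff)
    have "(\<Sum>f\<in>{f \<in> E. f \<inter> e = S}. p ^ card (e \<union> f))
        = (\<Sum>f\<in>{f \<in> E. f \<inter> e = S}. p ^ (k + (k - card S)))"
    proof (intro sum.cong refl)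
      fix f assume f: "f \<in> {f \<in> E. f \<inter> e = S}"
      then have "finite f" "card f = k" using assms by (auto simp: nsets_def)
      have "card e + card f = card (e \<union> f) + card (e \<inter> f)"
        using fe \<open>finite f\<close> by (intro card_Un_Int)
      moreover have "e \<inter> f = S" using f by auto
      ultimately have "card (e \<union> f) = k + (k - card S)"
        using fe \<open>card f = k\<close> \<open>card S < k\<close> by simp
      then show "p ^ card (e \<union> f) = p ^ (k + (k - card S))" by simp
    qed
    also have "\<dots> = real (card {f \<in> E. f \<inter> e = S}) * p ^ (k + (k - card S))" by simp
    also have "\<dots> \<le> D ^ (k - card S) * p ^ (k + (k - card S))"
    proof (rule mult_right_mono)
      have "card {f \<in> E. f \<inter> e = S} \<le> deg E S"
        unfolding deg_def using \<open>finite E\<close> by (intro card_mono) auto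
      moreover have "real (deg E S) \<le> D ^ (k - card S)"
        using balanced_power_iff[of D k V E] assms(1-3,5) \<open>S \<subseteq> e\<close> fe \<open>finite S\<close>
          \<open>1 \<le> card S\<close> \<open>card S < k\<close> by (auto simp: nsets_def)
      ultimately show "real (card {f \<in> E. f \<inter> e = S}) \<le> D ^ (k - card S)" by linarith
    qed (use p01 in auto)
    also have "\<dots> = p ^ k * (D * p) ^ (k - card S)" by (simp add: power_add power_mult_distrib)
    also have "\<dots> \<le> p ^ k * (D * p) ^ 1"
      using p01 \<open>card S < k\<close> one_le_power[of "2::real" "k + 1"]
      by (intro mult_left_mono power_decreasing) auto
    also have "\<dots> = p ^ k / 2 ^ (k + 1)" using p01 by simp
    finally show "(\<Sum>f\<in>{f \<in> E. f \<inter> e = S}. p ^ card (e \<union> f)) \<le> p ^ k / 2 ^ (k + 1)" .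
  qed
  also have "\<dots> = real (card ?P) * (p ^ k / 2 ^ (k + 1))" by simp
  also have "\<dots> \<le> 2 ^ k * (p ^ k / 2 ^ (k + 1))"
  proof (rule mult_right_mono)
    have "card ?P \<le> card (Pow e)" using fe by (intro card_mono) auto
    then have "card ?P \<le> 2 ^ k" using fe by (simp add: card_Pow)
    then show "real (card ?P) \<le> 2 ^ k" by (metis of_nat_le_iff of_nat_numeral of_nat_power)
  qed (use p01 in auto)
  also have "\<dots> = p ^ k / 2" by simp
  finally show ?thesis .
qed

text \<open>If the random set contains \<open>e\<close> but its core does not, then it contains
  \<open>e \<union> f\<close> for some edge \<open>f\<close> meeting \<open>e\<close>. By the union
  bound this loses at most half of the probability \<open>p ^ k\<close> that \<open>e\<close>
  survives.\<close>

lemma weight_core_superset_ge: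
  assumes "finite V" "2 \<le> k" "1 \<le> D" "E \<subseteq> nsets V k" "balanced k (D ^ (k - 1)) V E"
    and e: "e \<in> nsets V k" "e \<notin> E"
    and p: "p = 1 / (2 ^ (k + 1) * D)"
  shows "p ^ k / 2 \<le> (\<Sum>R\<in>{R \<in> Pow V. e \<subseteq> core E R}. weight p V R)"
proof -
  have "finite E" using assms by (meson finite_subset finite_imp_finite_nsets)
  have fe: "finite e" "card e = k" "e \<subseteq> V" using e by (auto simp: nsets_def)
  have "1 \<le> 2 ^ (k + 1) * D" by (rule one_le_scaled[OF assms(3)])
  then have "0 < p" "p \<le> 1" using assms(3) by (auto simp: p divide_le_eq_1 simp del: power_Suc)
  then have w: "0 \<le> weight p V R" for R by (simp add: weight_def)
  let ?M = "{f. f \<in> E \<and> f \<inter> e \<noteq> {}}"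
  have "p ^ k = (\<Sum>R\<in>{R \<in> Pow V. e \<subseteq> R}. weight p V R)"
    using sum_weight_superset[OF assms(1) fe(3)] fe by simp
  also have "\<dots> \<le> (\<Sum>R\<in>{R \<in> Pow V. e \<subseteq> core E R} \<union> (\<Union>f\<in>?M. {R \<in> Pow V. e \<union> f \<subseteq> R}).
      weight p V R)"
    using assms(1) \<open>finite E\<close> w by (intro sum_mono2) (auto simp: core_def)
  also have "\<dots> \<le> (\<Sum>R\<in>{R \<in> Pow V. e \<subseteq> core E R}. weight p V R)
      + (\<Sum>R\<in>(\<Union>f\<in>?M. {R \<in> Pow V. e \<union> f \<subseteq> R}). weight p V R)"
  proof -
    let ?A = "{R \<in> Pow V. e \<subseteq> core E R}" and ?B = "\<Union>f\<in>?M. {R \<in> Pow V. e \<union> f \<subseteq> R}"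
    have "finite ?A" "finite ?B" using assms(1) \<open>finite E\<close> by auto
    then show ?thesis
      using sum.union_inter[of ?A ?B "weight p V"] sum_nonneg[of "?A \<inter> ?B" "weight p V"] w
      by simp
  qed
  also have "(\<Sum>R\<in>(\<Union>f\<in>?M. {R \<in> Pow V. e \<union> f \<subseteq> R}). weight p V R)
      \<le> (\<Sum>f\<in>?M. \<Sum>R\<in>{R \<in> Pow V. e \<union> f \<subseteq> R}. weight p V R)"
    using assms(1) \<open>finite E\<close> w by (intro sum_UNION_le) auto
  also have "\<dots> = (\<Sum>f\<in>?M. p ^ card (e \<union> f))"
  proof (intro sum.cong refl)
    fix f assume "f \<in> ?M"
    then have "e \<union> f \<subseteq> V" using assms(4) fe by (auto simp: nsets_def)
    then show "(\<Sum>R\<in>{R \<in> Pow V. e \<union> f \<subseteq> R}. weight p V R) = p ^ card (e \<union> f)"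
      using sum_weight_superset assms(1) by blast
  qed
  also have "\<dots> \<le> p ^ k / 2" by (rule sum_edges_meeting_le[OF assms])
  finally show ?thesis by simp
qed

text \<open>First moment argument: the expected number of members of \<open>X\<close> inside the
  core is at least \<open>card X * p ^ k / 2\<close>, and some \<open>R\<close> reaches the
  expectation.\<close>

lemma exists_independent_covering_fraction:
  assumes "finite V" "2 \<le> k" "1 \<le> D" "E \<subseteq> nsets V k" "balanced k (D ^ (k - 1)) V E"
    and X: "X \<subseteq> complement_edges k V E"
  obtains I where "independent_in V E I"
    "real (card X) / (2 * (2 ^ (k + 1) * D) ^ k) \<le> real (card {e \<in> X. e \<subseteq> I})"
proof -
  define p where "p = 1 / (2 ^ (k + 1) * D)"
  have "finite X" using finite_subset[OF X finite_complement_edges[OF assms(1)]] .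
  have "1 \<le> 2 ^ (k + 1) * D" by (rule one_le_scaled[OF assms(3)])
  then have "0 < p" "p \<le> 1" using assms(3) by (auto simp: p_def divide_le_eq_1 simp del: power_Suc)
  then have w: "0 \<le> weight p V R" for R by (simp add: weight_def)
  let ?N = "\<lambda>R. real (card {e \<in> X. e \<subseteq> core E R})"
  have "real (card X) * (p ^ k / 2) = (\<Sum>e\<in>X. p ^ k / 2)" by simp
  also have "\<dots> \<le> (\<Sum>e\<in>X. \<Sum>R\<in>{R \<in> Pow V. e \<subseteq> core E R}. weight p V R)"
    using X
    by (intro sum_mono weight_core_superset_ge[OF assms(1-5) _ _ p_def])
      (auto simp: complement_edges_def)
  also have "\<dots> = (\<Sum>e\<in>X. \<Sum>R\<in>Pow V. if e \<subseteq> core E R then weight p V R else 0)"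
  proof (rule sum.cong[OF refl])
    fix e show "(\<Sum>R\<in>{R \<in> Pow V. e \<subseteq> core E R}. weight p V R)
        = (\<Sum>R\<in>Pow V. if e \<subseteq> core E R then weight p V R else 0)"
      using assms(1) by (intro sum.inter_filter) auto
  qed
  also have "\<dots> = (\<Sum>R\<in>Pow V. \<Sum>e\<in>X. if e \<subseteq> core E R then weight p V R else 0)"
    by (rule sum.swap)
  also have "\<dots> = (\<Sum>R\<in>Pow V. ?N R * weight p V R)"
    using \<open>finite X\<close> by (simp add: sum.inter_filter[symmetric])
  finally have le: "real (card X) * (p ^ k / 2) \<le> (\<Sum>R\<in>Pow V. ?N R * weight p V R)" .
  have one: "(\<Sum>R\<in>Pow V. weight p V R) = 1"
    using sum_weight_superset[OF assms(1), of "{}" p] by (simp add: Pow_def)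
  have "\<exists>R\<in>Pow V. real (card X) * (p ^ k / 2) \<le> ?N R"
  proof (rule ccontr)
    assume "\<not> ?thesis"
    then have lt: "?N R < real (card X) * (p ^ k / 2)" if "R \<in> Pow V" for R
      using that by (meson not_le)
    \<comment> \<open>Strictness of the averaged inequality needs one \<open>R\<close> of positive
      weight; it exists because the weights sum to 1.\<close>
    have "\<exists>R\<in>Pow V. weight p V R \<noteq> 0"
      using one by (metis sum.neutral zero_neq_one)
    then obtain R0 where R0: "R0 \<in> Pow V" "0 < weight p V R0"
      using w by (auto simp: less_le)
    have "(\<Sum>R\<in>Pow V. ?N R * weight p V R)
        < (\<Sum>R\<in>Pow V. real (card X) * (p ^ k / 2) * weight p V R)"
    proof (rule sum_strict_mono_ex1)
      show "\<forall>R\<in>Pow V. ?N R * weight p V R \<le> real (card X) * (p ^ k / 2) * weight p V R"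
        using lt w by (intro ballI mult_right_mono) (auto intro: less_imp_le)
      show "\<exists>R\<in>Pow V. ?N R * weight p V R < real (card X) * (p ^ k / 2) * weight p V R"
        using lt R0 by (intro bexI[of _ R0] mult_strict_right_mono)
    qed (use assms(1) in simp)
    also have "\<dots> = real (card X) * (p ^ k / 2)"
      by (simp only: sum_distrib_left[symmetric] one mult_1_right)
    finally show False using le by simp
  qed
  then obtain R where "R \<in> Pow V" "real (card X) * (p ^ k / 2) \<le> ?N R" by blast
  moreover have "independent_in V E (core E R)"
    using \<open>R \<in> Pow V\<close> assms(2,4) by (intro independent_core) (auto simp: nsets_def)
  moreover have "real (card X) * (p ^ k / 2) = real (card X) / (2 * (2 ^ (k + 1) * D) ^ k)"
    by (simp add: p_def power_divide)
  ultimately show thesis using that by metis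
qed

text \<open>Each new set is chosen for the non-edges still uncovered and leaves at most the fraction
  \<open>1 - ?\<rho>\<close> of them.\<close>

lemma greedy_cover:
  assumes "finite V" "2 \<le> k" "1 \<le> D" "E \<subseteq> nsets V k" "balanced k (D ^ (k - 1)) V E"
  shows "\<exists>I. (\<forall>j\<in>{1..t}. independent_in V E (I j)) \<and>
    real (card {e \<in> complement_edges k V E. \<forall>j\<in>{1..t}. \<not> e \<subseteq> I j})
      \<le> (1 - 1 / (2 * (2 ^ (k + 1) * D) ^ k)) ^ t * real (card (complement_edges k V E))"
proof (induction t)
  case 0
  show ?case by simp
next
  case (Suc t)
  let ?\<rho> = "1 / (2 * (2 ^ (k + 1) * D) ^ k)"
  have fin: "finite (complement_edges k V E)"
    by (rule finite_complement_edges[OF assms(1)])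
  from Suc obtain I where I: "\<forall>j\<in>{1..t}. independent_in V E (I j)"
    "real (card {e \<in> complement_edges k V E. \<forall>j\<in>{1..t}. \<not> e \<subseteq> I j})
      \<le> (1 - ?\<rho>) ^ t * real (card (complement_edges k V E))" by blast
  define X where "X = {e \<in> complement_edges k V E. \<forall>j\<in>{1..t}. \<not> e \<subseteq> I j}"
  have "finite X" using fin by (simp add: X_def)
  obtain J where J: "independent_in V E J" "real (card X) * ?\<rho> \<le> real (card {e \<in> X. e \<subseteq> J})"
    using exists_independent_covering_fraction[OF assms, of X] by (auto simp: X_def)
  let ?I = "I(Suc t := J)"
  have "{e \<in> complement_edges k V E. \<forall>j\<in>{1..Suc t}. \<not> e \<subseteq> ?I j} = X - {e \<in> X. e \<subseteq> J}"
    by (auto simp: X_def atLeastAtMostSuc_conv)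
  then have "real (card {e \<in> complement_edges k V E. \<forall>j\<in>{1..Suc t}. \<not> e \<subseteq> ?I j})
      = real (card X) - real (card {e \<in> X. e \<subseteq> J})"
    using \<open>finite X\<close> by (simp add: card_Diff_subset card_mono of_nat_diff)
  also have "\<dots> \<le> (1 - ?\<rho>) * real (card X)" using J(2) by (simp add: algebra_simps)
  also have "\<dots> \<le> (1 - ?\<rho>) * ((1 - ?\<rho>) ^ t * real (card (complement_edges k V E)))"
  proof (rule mult_left_mono)
    have "1 \<le> (2 ^ (k + 1) * D) ^ k" by (rule one_le_power[OF one_le_scaled[OF assms(3)]])
    then show "0 \<le> 1 - ?\<rho>" by (simp add: divide_simps)
  qed (use I(2) X_def in simp)
  finally show ?case using I(1) J(1)
    by (intro exI[of _ ?I] conjI) (auto simp: atLeastAtMostSuc_conv)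
qed

lemma half_le_ln_2: "1 / 2 \<le> ln (2::real)"
  using ln_le_minus_one[of "1 / 2 :: real"] by (simp add: ln_div)

text \<open>There are at most \<open>n ^ k\<close> non-edges, so \<open>t\<close> greedy steps leave
  at most \<open>exp (k * ln n - t / ?A)\<close> of them. This is below 1, hence zero, once
  \<open>t > k * ?A * ln n\<close>.\<close>

lemma theta_upper_bound:
  assumes "kgraph k V E" "2 \<le> k" "1 \<le> D" "balanced k (D ^ (k - 1)) V E" "2 \<le> card V"
  shows "real (theta k V E) \<le> (2 * real k * (2 ^ (k + 1)) ^ k + 2) * D ^ k * ln (card V)"
proof -
  have fin: "finite V" "E \<subseteq> nsets V k" using assms by (auto simp: kgraph_def)
  let ?n = "card V" and ?A = "2 * (2 ^ (k + 1) * D) ^ k"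
  let ?t = "nat \<lfloor>k * ?A * ln ?n\<rfloor> + 1"
  have A1: "1 \<le> (2 ^ (k + 1) * D) ^ k"
  proof -
    show ?thesis by (rule one_le_power[OF one_le_scaled[OF assms(3)]])
  qed
  have ln2: "1 / 2 \<le> ln (real ?n)"
    using order_trans[OF half_le_ln_2 ln_mono[of 2 "real ?n"]] assms(5) by simp
  obtain I where I: "\<forall>j\<in>{1..?t}. independent_in V E (I j)"
    "real (card {e \<in> complement_edges k V E. \<forall>j\<in>{1..?t}. \<not> e \<subseteq> I j})
      \<le> (1 - 1 / ?A) ^ ?t * real (card (complement_edges k V E))"
    using greedy_cover[OF fin(1) assms(2,3) fin(2) assms(4), of ?t] by blast
  have "card (complement_edges k V E) \<le> card (nsets V k)"
    using fin by (intro card_mono) (auto simp: complement_edges_def finite_imp_finite_nsets)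
  also have "\<dots> = ?n choose k" using fin by (simp add: card_nsets)
  also have "\<dots> \<le> ?n ^ k" by (cases "k \<le> ?n") (auto simp: binomial_le_pow binomial_eq_0)
  finally have card: "real (card (complement_edges k V E)) \<le> real ?n ^ k"
    by (metis of_nat_le_iff of_nat_power)
  have "(1 - 1 / ?A) ^ ?t * real (card (complement_edges k V E))
      \<le> exp (- (1 / ?A)) ^ ?t * exp (ln ?n) ^ k"
  proof (intro mult_mono power_mono)
    show "1 - 1 / ?A \<le> exp (- (1 / ?A))" using exp_ge_add_one_self[of "- (1 / ?A)"] by linarith
    show "0 \<le> 1 - 1 / ?A" using A1 by (simp add: divide_le_eq_1)
    show "real (card (complement_edges k V E)) \<le> exp (ln ?n) ^ k" using card assms(5) by simp
  qed auto
  also have "\<dots> = exp (?t * - (1 / ?A) + k * ln ?n)"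
    by (simp only: exp_add exp_of_nat_mult)
  also have "\<dots> < 1"
  proof -
    have "k * ?A * ln ?n < ?t" using ln2 A1 by linarith
    then have "k * ln ?n < ?t / ?A" using A1 by (simp only: pos_less_divide_eq mult_ac)
    then show ?thesis by simp
  qed
  finally have "card {e \<in> complement_edges k V E. \<forall>j\<in>{1..?t}. \<not> e \<subseteq> I j} = 0"
    using I(2) by linarith
  then have "{e \<in> complement_edges k V E. \<forall>j\<in>{1..?t}. \<not> e \<subseteq> I j} = {}"
    using finite_complement_edges[OF fin(1), of k E] by simp
  then have "cover k V E ?t I" using I(1) unfolding cover_def by blast
  then have "theta k V E \<le> ?t" by (intro theta_le) auto
  also have "real ?t \<le> k * ?A * ln ?n + 1"
    using ln2 A1 by simp
  \<comment> \<open>The 1 from rounding is absorbed using \<open>ln n \<ge> 1 / 2\<close> and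
    \<open>D \<ge> 1\<close>; it accounts for the \<open>+ 2\<close> in the constant.\<close>
  also have "\<dots> \<le> k * ?A * ln ?n + 2 * D ^ k * ln ?n"
  proof -
    have "1 * (1 / 2) \<le> D ^ k * ln ?n" using ln2 assms(3) by (intro mult_mono) auto
    then show ?thesis by simp
  qed
  also have "\<dots> = (2 * real k * (2 ^ (k + 1)) ^ k + 2) * D ^ k * ln ?n"
    by (simp add: algebra_simps power_mult_distrib)
  finally show ?thesis by (simp add: add.commute)
qed

subsection \<open>Lower bound\<close>

context
  fixes N k m :: nat
  assumes k2: "2 \<le> k"
begin

text \<open>A vertex \<open>(x, j, a)\<close> has row \<open>x\<close>, column \<open>j\<close> and
  label \<open>a\<close>.\<close>

definition verts :: "(nat \<times> nat \<times> nat) set" where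
  "verts = {..<N} \<times> {..<k} \<times> {..<m}"

definition labels :: "(nat \<Rightarrow> nat) set" where
  "labels = {..<k} \<rightarrow>\<^sub>E {..<m}"

definition perms :: "((nat \<Rightarrow> nat) \<Rightarrow> nat \<Rightarrow> nat) set" where
  "perms = labels \<rightarrow>\<^sub>E {\<sigma>. \<sigma> permutes {..<N}}"

text \<open>One vertex per column, with labels \<open>f\<close>. The columns other than 0 are all
  shifted by the same \<open>\<sigma>\<close>, so column 0 shows \<open>x\<close> and column 1 shows
  \<open>\<sigma> x\<close>.\<close>

definition transversal :: "(nat \<Rightarrow> nat) \<Rightarrow> (nat \<Rightarrow> nat) \<Rightarrow> nat \<Rightarrow> (nat \<times> nat \<times> nat) set" where
  "transversal f \<sigma> x = (\<lambda>j. (if j = 0 then x else \<sigma> x, j, f j)) ` {..<k}"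

definition transversals :: "((nat \<Rightarrow> nat) \<Rightarrow> nat \<Rightarrow> nat) \<Rightarrow> (nat \<times> nat \<times> nat) set set" where
  "transversals \<pi> = {transversal f (\<pi> f) x | f x. f \<in> labels \<and> x < N}"

definition block :: "nat \<Rightarrow> nat \<Rightarrow> (nat \<times> nat \<times> nat) set" where
  "block x j = {x} \<times> {j} \<times> {..<m}"

definition cliques :: "(nat \<times> nat \<times> nat) set set" where
  "cliques = (\<Union>x<N. \<Union>j<k. nsets (block x j) k)"

lemma finite_verts [simp]: "finite verts" and card_verts: "card verts = N * (k * m)"
  by (auto simp: verts_def)

lemma finite_labels [simp]: "finite labels" and card_labels: "card labels = m ^ k"
  by (auto simp: labels_def card_PiE intro: finite_PiE)

lemma card_perms: "card perms = fact N ^ (m ^ k)"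
  by (simp add: perms_def card_PiE card_labels card_permutations)

lemma perms_permutes: "\<pi> \<in> perms \<Longrightarrow> f \<in> labels \<Longrightarrow> \<pi> f permutes {..<N}"
  by (auto simp: perms_def)

lemma transversals_subset:
  assumes "\<pi> \<in> perms"
  shows "transversals \<pi> \<subseteq> nsets verts k"
proof
  fix e assume "e \<in> transversals \<pi>"
  then obtain f x where e: "e = transversal f (\<pi> f) x" "f \<in> labels" "x < N"
    by (auto simp: transversals_def)
  then have "\<pi> f x < N"
    using permutes_in_image[OF perms_permutes[OF assms], of f x] by auto
  then have "e \<subseteq> verts" using e by (auto simp: verts_def transversal_def labels_def PiE_iff)
  moreover have "card e = k"
    unfolding e(1) transversal_def by (subst card_image) (auto simp: inj_on_def)
  moreover have "finite e" by (simp add: e(1) transversal_def)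
  ultimately show "e \<in> nsets verts k" by (simp add: nsets_def)
qed

lemma cliques_subset: "cliques \<subseteq> nsets verts k"
  by (fastforce simp: cliques_def nsets_def block_def verts_def)

text \<open>A clique edge stays in one column, while a transversal meets columns 0 and 1.\<close>

lemma transversal_not_clique: "transversal f \<sigma> x \<notin> cliques"
proof
  assume "transversal f \<sigma> x \<in> cliques"
  then obtain y j where "transversal f \<sigma> x \<subseteq> {y} \<times> {j} \<times> {..<m}"
    by (auto simp: cliques_def nsets_def block_def)
  moreover have "(x, 0, f 0) \<in> transversal f \<sigma> x" "(\<sigma> x, 1, f 1) \<in> transversal f \<sigma> x"
    using k2 by (force simp: transversal_def)+
  ultimately show False by auto
qed

lemma transversal_eqD:
  assumes "transversal f \<sigma> x = transversal g \<tau> y"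
  shows "x = y" "\<sigma> x = \<tau> y" "\<And>j. j < k \<Longrightarrow> f j = g j"
proof -
  have *: "(if j = 0 then x else \<sigma> x) = (if j = 0 then y else \<tau> y) \<and> f j = g j" if "j < k" for j
  proof -
    have "(if j = 0 then x else \<sigma> x, j, f j) \<in> transversal f \<sigma> x"
      unfolding transversal_def using that by blast
    then have "(if j = 0 then x else \<sigma> x, j, f j) \<in> transversal g \<tau> y"
      by (simp only: assms)
    then show ?thesis by (auto simp: transversal_def split: if_splits)
  qed
  show "x = y" "\<sigma> x = \<tau> y" using *[of 0] *[of 1] k2 by auto
  show "\<And>j. j < k \<Longrightarrow> f j = g j" using * by blast
qed

text \<open>Transversals can be told apart from clique edges, and each one reveals its labels
  \<open>f\<close>, its row \<open>x\<close> and the value \<open>\<pi> f x\<close>. So the graph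
  determines every permutation.\<close>

lemma inj_on_transversals: "inj_on (\<lambda>\<pi>. transversals \<pi> \<union> cliques) perms"
proof (rule inj_onI)
  fix \<pi> \<rho> assume \<pi>: "\<pi> \<in> perms" and \<rho>: "\<rho> \<in> perms"
    and eq: "transversals \<pi> \<union> cliques = transversals \<rho> \<union> cliques"
  have "\<pi> f = \<rho> f" if f: "f \<in> labels" for f
  proof
    fix x
    show "\<pi> f x = \<rho> f x"
    proof (cases "x < N")
      case True
      then have "transversal f (\<pi> f) x \<in> transversals \<pi>"
        using f by (auto simp: transversals_def)
      then have "transversal f (\<pi> f) x \<in> transversals \<rho>"
        using eq transversal_not_clique by blast
      then obtain g y where g: "transversal f (\<pi> f) x = transversal g (\<rho> g) y" "g \<in> labels"
        by (auto simp: transversals_def)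
      have "f = g"
      proof (rule PiE_ext)
        show "f \<in> {..<k} \<rightarrow>\<^sub>E {..<m}" "g \<in> {..<k} \<rightarrow>\<^sub>E {..<m}"
          using f g by (simp_all add: labels_def)
      qed (use transversal_eqD[OF g(1)] in auto)
      then show ?thesis using transversal_eqD[OF g(1)] by simp
    next
      case False
      then show ?thesis
        using perms_permutes[OF \<pi> f] perms_permutes[OF \<rho> f] by (simp add: permutes_def)
    qed
  qed
  then show "\<pi> = \<rho>" using \<pi> \<rho> unfolding perms_def by (intro PiE_ext) auto
qed

text \<open>A set \<open>S\<close> inside a transversal occupies \<open>i\<close> columns and fixes
  the labels there. Any single vertex of \<open>S\<close> then fixes the row \<open>x\<close>,
  because \<open>\<pi> f\<close> is a bijection. Only the labels of the other \<open>k - i\<close>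
  columns are free.\<close>

lemma deg_transversals_le:
  assumes "\<pi> \<in> perms" "S \<in> nsets verts i" "1 \<le> i"
  shows "deg (transversals \<pi>) S \<le> m ^ (k - i)"
proof (cases "{e \<in> transversals \<pi>. S \<subseteq> e} = {}")
  case True
  show ?thesis unfolding deg_def True by simp
next
  case False
  have S: "finite S" "card S = i" using assms by (auto simp: nsets_def)
  define col :: "nat \<times> nat \<times> nat \<Rightarrow> nat" where "col = (\<lambda>v. fst (snd v))"
  define J where "J = col ` S"
  \<comment> \<open>The label that \<open>S\<close> prescribes in column \<open>j\<close>, common to
    all transversals containing \<open>S\<close>.\<close>
  define lab where "lab j = (SOME a. \<exists>y. (y, j, a) \<in> S)" for j
  obtain y0 j0 a0 where v0: "(y0, j0, a0) \<in> S"
    using S assms(3) by (cases "S = {}") auto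
  have lab: "f j = lab j" if "S \<subseteq> transversal f \<sigma> x" "j \<in> J" for f \<sigma> x j
  proof -
    have "\<exists>a y. (y, j, a) \<in> S" using that(2) unfolding J_def col_def by fastforce
    then have "\<exists>y. (y, j, lab j) \<in> S" unfolding lab_def by (rule someI_ex)
    then show ?thesis using that(1) by (auto simp: transversal_def)
  qed
  from False obtain f1 \<sigma>1 x1 where S1: "S \<subseteq> transversal f1 \<sigma>1 x1"
    by (auto simp: transversals_def)
  have "inj_on col (transversal f1 \<sigma>1 x1)"
    by (auto simp: inj_on_def transversal_def col_def)
  then have "inj_on col S" using S1 by (rule inj_on_subset)
  then have cardJ: "card J = i" using S by (simp add: J_def card_image)
  have "J \<subseteq> {..<k}" using S1 by (auto simp: J_def transversal_def col_def)
  define F where "F h = (\<lambda>j. if j \<in> J then lab j else h j)" for h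
  \<comment> \<open>Recovers the row from the chosen vertex of \<open>S\<close>: column 0 shows it
    directly, every other column shows its image under \<open>\<pi> f\<close>.\<close>
  define X where "X f = (if j0 = 0 then y0 else inv (\<pi> f) y0)" for f
  have "{e \<in> transversals \<pi>. S \<subseteq> e}
      \<subseteq> (\<lambda>h. transversal (F h) (\<pi> (F h)) (X (F h))) ` (({..<k} - J) \<rightarrow>\<^sub>E {..<m})"
  proof
    fix e assume "e \<in> {e \<in> transversals \<pi>. S \<subseteq> e}"
    then obtain f x where e: "e = transversal f (\<pi> f) x" "S \<subseteq> e" "f \<in> labels"
      by (auto simp: transversals_def)
    let ?h = "restrict f ({..<k} - J)"
    have "F ?h = f"
    proof
      fix j show "F ?h j = f j"
        using lab[of f "\<pi> f" x j] e PiE_arb[of f "{..<k}" "\<lambda>_. {..<m}" j]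
        by (auto simp: F_def labels_def)
    qed
    moreover have "X f = x"
      using v0 e permutes_inverses(2)[OF perms_permutes[OF assms(1) e(3)]]
      by (auto simp: X_def transversal_def)
    moreover have "?h \<in> ({..<k} - J) \<rightarrow>\<^sub>E {..<m}"
      using e(3) by (auto simp: labels_def)
    ultimately show "e \<in> (\<lambda>h. transversal (F h) (\<pi> (F h)) (X (F h))) ` (({..<k} - J) \<rightarrow>\<^sub>E {..<m})"
      using e(1) by (intro image_eqI[of _ _ ?h]) simp_all
  qed
  then have "deg (transversals \<pi>) S \<le> card (({..<k} - J) \<rightarrow>\<^sub>E {..<m})"
    unfolding deg_def by (rule surj_card_le[rotated]) (auto intro: finite_PiE)
  also have "\<dots> = m ^ (k - i)"
    using \<open>J \<subseteq> {..<k}\<close> cardJ S by (simp add: card_PiE card_Diff_subset J_def)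
  finally show ?thesis .
qed

text \<open>A vertex of \<open>S\<close> fixes the block, and an edge is then given by its
  \<open>k - i\<close> further vertices in that block.\<close>

lemma deg_cliques_le:
  assumes "S \<in> nsets verts i" "1 \<le> i" "i \<le> k"
  shows "deg cliques S \<le> m ^ (k - i)"
proof -
  have S: "finite S" "card S = i" using assms by (auto simp: nsets_def)
  obtain y j a where v: "(y, j, a) \<in> S"
    using S assms(2) by (cases "S = {}") auto
  have "{e \<in> cliques. S \<subseteq> e} \<subseteq> (\<lambda>T. S \<union> T) ` nsets (block y j - S) (k - i)"
  proof
    fix e assume "e \<in> {e \<in> cliques. S \<subseteq> e}"
    then obtain y' j' where e: "e \<in> nsets (block y' j') k" "S \<subseteq> e"
      by (auto simp: cliques_def)
    then have "y' = y" "j' = j" using v by (auto simp: nsets_def block_def)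
    then have "e - S \<in> nsets (block y j - S) (k - i)"
      using e S by (auto simp: nsets_def card_Diff_subset)
    moreover have "e = S \<union> (e - S)" using e by auto
    ultimately show "e \<in> (\<lambda>T. S \<union> T) ` nsets (block y j - S) (k - i)" by blast
  qed
  then have "deg cliques S \<le> card (nsets (block y j - S) (k - i))"
    unfolding deg_def
    by (rule surj_card_le[rotated]) (simp add: block_def finite_imp_finite_nsets)
  also have "\<dots> \<le> m ^ (k - i)"
  proof -
    have "card (block y j - S) \<le> card (block y j)" by (intro card_mono) (auto simp: block_def)
    then have le: "card (block y j - S) \<le> m" by (simp add: block_def)
    have "card (block y j - S) choose (k - i) \<le> card (block y j - S) ^ (k - i)"
      by (cases "k - i \<le> card (block y j - S)") (auto simp: binomial_le_pow binomial_eq_0)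
    also have "\<dots> \<le> m ^ (k - i)" using le by (intro power_mono) auto
    finally show ?thesis by simp
  qed
  finally show ?thesis .
qed

lemma cliques_empty: "m < k \<Longrightarrow> cliques = {}"
proof -
  assume "m < k"
  have "nsets (block x j) k = {}" for x j
    using \<open>m < k\<close> by (intro nsets_eq_empty) (simp_all add: block_def)
  then show ?thesis by (simp add: cliques_def)
qed

text \<open>For \<open>i < k\<close> the two degree bounds add up to
  \<open>2 * m ^ (k - i) \<le> (2 * m) ^ (k - i)\<close>. For \<open>m = 1\<close> there are no
  cliques, so no factor 2 is lost and \<open>D\<close> may be as small as 1.\<close>

lemma balanced_transversals_cliques:
  assumes "\<pi> \<in> perms" "2 * real m \<le> D \<or> m = 1 \<and> 1 \<le> D" "0 < D"
  shows "balanced k (D ^ (k - 1)) verts (transversals \<pi> \<union> cliques)"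
  unfolding balanced_power_iff[OF assms(3) k2 finite_verts]
proof (intro ballI)
  fix i S assume i: "i \<in> {1..k}" and S: "S \<in> nsets verts i"
  let ?E = "transversals \<pi> \<union> cliques"
  have E: "?E \<subseteq> nsets verts k"
    using transversals_subset[OF assms(1)] cliques_subset by simp
  show "real (deg ?E S) \<le> D ^ (k - i)"
  proof (cases "i = k")
    case True
    then have "deg ?E S \<le> 1" using deg_full_le_1 E S by blast
    then show ?thesis using True by simp
  next
    case False
    have un: "deg ?E S \<le> deg (transversals \<pi>) S + deg cliques S"
    proof -
      have "{e \<in> ?E. S \<subseteq> e} = {e \<in> transversals \<pi>. S \<subseteq> e} \<union> {e \<in> cliques. S \<subseteq> e}" by auto
      then have "deg ?E S = card ({e \<in> transversals \<pi>. S \<subseteq> e} \<union> {e \<in> cliques. S \<subseteq> e})"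
        unfolding deg_def by (rule arg_cong)
      also have "\<dots> \<le> deg (transversals \<pi>) S + deg cliques S"
        unfolding deg_def by (rule card_Un_le)
      finally show ?thesis .
    qed
    have t: "deg (transversals \<pi>) S \<le> m ^ (k - i)"
      using deg_transversals_le assms(1) S i by simp
    show ?thesis
    proof (cases "m = 1 \<and> 1 \<le> D")
      case True
      then have "cliques = {}" using cliques_empty k2 by simp
      then have "deg ?E S \<le> 1" using t True by simp
      moreover have "1 \<le> D ^ (k - i)" using True by (intro one_le_power) simp
      ultimately show ?thesis by linarith
    next
      case c: False
      have "deg cliques S \<le> m ^ (k - i)" using deg_cliques_le S i by simp
      then have "deg ?E S \<le> 2 * m ^ (k - i)" using un t by simp
      also have "\<dots> \<le> 2 ^ (k - i) * m ^ (k - i)"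
        using False i self_le_power[of "2::nat" "k - i"] by (intro mult_right_mono) auto
      also have "\<dots> = (2 * m) ^ (k - i)" by (simp add: power_mult_distrib)
      finally have "real (deg ?E S) \<le> real ((2 * m) ^ (k - i))" by (simp only: of_nat_le_iff)
      also have "\<dots> = (2 * real m) ^ (k - i)" by simp
      also have "\<dots> \<le> D ^ (k - i)" using assms(2) c by (intro power_mono) auto
      finally show ?thesis .
    qed
  qed
qed

text \<open>Each of the \<open>N * k\<close> blocks is a clique and contributes at most
  \<open>k - 1\<close> vertices. The bound is independent of \<open>m\<close>, although there are
  \<open>N * k * m\<close> vertices.\<close>

lemma card_independent_le:
  assumes "independent_in verts (transversals \<pi> \<union> cliques) I"
  shows "card I \<le> N * (k * (k - 1))"
proof -
  have I: "I \<subseteq> verts" "\<And>e. e \<in> cliques \<Longrightarrow> \<not> e \<subseteq> I"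
    using assms by (auto simp: independent_in_def)
  have blk: "card (I \<inter> block x j) \<le> k - 1" if "x < N" "j < k" for x j
  proof (rule ccontr)
    assume "\<not> ?thesis"
    then have "k \<le> card (I \<inter> block x j)" by simp
    then obtain e where e: "e \<subseteq> I \<inter> block x j" "card e = k" "finite e"
      using obtain_subset_with_card_n by metis
    then have "e \<in> cliques" using that by (auto simp: cliques_def nsets_def)
    then show False using I(2) e by auto
  qed
  have "I = (\<Union>p\<in>{..<N} \<times> {..<k}. I \<inter> block (fst p) (snd p))"
    using I(1) by (force simp: verts_def block_def)
  then have "card I = card (\<Union>p\<in>{..<N} \<times> {..<k}. I \<inter> block (fst p) (snd p))"
    by (rule arg_cong)
  also have "\<dots> \<le> (\<Sum>p\<in>{..<N} \<times> {..<k}. card (I \<inter> block (fst p) (snd p)))"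
    by (intro card_UN_le) simp
  also have "\<dots> \<le> (\<Sum>p\<in>{..<N} \<times> {..<k}. k - 1)"
    using blk by (intro sum_mono) auto
  also have "\<dots> = N * (k * (k - 1))" by simp
  finally show ?thesis .
qed

end

section \<open>Two counting estimates\<close>

text \<open>Each counted set has \<open>(1 / x) ^ s * x ^ card I \<ge> 1\<close>; summing this over
  all subsets and applying the binomial theorem gives the bound.\<close>

lemma card_bounded_subsets_le:
  assumes "finite V" "0 < x" "x \<le> 1"
  shows "real (card {I \<in> Pow V. card I \<le> s}) \<le> (1 / x) ^ s * (1 + x) ^ card V"
proof -
  have "real (card {I \<in> Pow V. card I \<le> s}) = (\<Sum>I\<in>{I \<in> Pow V. card I \<le> s}. 1)" by simp
  also have "\<dots> \<le> (\<Sum>I\<in>{I \<in> Pow V. card I \<le> s}. (1 / x) ^ s * x ^ card I)"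
  proof (intro sum_mono)
    fix I assume "I \<in> {I \<in> Pow V. card I \<le> s}"
    then have "x ^ s \<le> x ^ card I" using assms by (intro power_decreasing) auto
    then show "1 \<le> (1 / x) ^ s * x ^ card I" using assms by (simp add: power_divide)
  qed
  also have "\<dots> \<le> (\<Sum>I\<in>Pow V. (1 / x) ^ s * x ^ card I)"
    using assms by (intro sum_mono2) auto
  also have "\<dots> = (1 / x) ^ s * (1 + x) ^ card V"
    using sum_Pow_power[OF assms(1), of x] by (simp only: sum_distrib_left[symmetric])
  finally show ?thesis .
qed

text \<open>In the product of two copies of \<open>fact n\<close>, pair the factors as
  \<open>(i + 1) * (n - i)\<close>; each pair is at least \<open>n\<close>.\<close>

lemma power_le_fact_power2: "n ^ n \<le> (fact n :: nat) ^ 2"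
proof -
  have rev: "(\<Prod>i<n. n - i) = fact n"
    by (simp add: fact_prod_rev lessThan_atLeast0)
  have "n ^ n = (\<Prod>i<n. n)" by simp
  also have "\<dots> \<le> (\<Prod>i<n. Suc i * (n - i))"
  proof (intro prod_mono conjI)
    fix i assume "i \<in> {..<n}"
    then obtain d where "n = Suc i + d" by (auto dest: less_imp_Suc_add)
    then show "n \<le> Suc i * (n - i)" by simp
  qed simp
  also have "\<dots> = (\<Prod>i<n. Suc i) * (\<Prod>i<n. n - i)" by (rule prod.distrib)
  also have "(\<Prod>i<n. Suc i) = fact n"
    by (simp add: fact_prod_Suc lessThan_atLeast0)
  finally show ?thesis by (simp add: rev power2_eq_square)
qed

section \<open>From \<open>theta\<close> to \<open>b\<close>\<close>

text \<open>The \<open>Max\<close> defining \<open>b\<close> is meaningful only on a finite set; the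
  uniform upper bound on \<open>theta\<close> provides finiteness.\<close>

lemma finite_theta_values:
  assumes "2 \<le> k" "1 \<le> D" "2 \<le> n"
  shows "finite {theta k V E | (V :: nat set) E.
    kgraph k V E \<and> card V = n \<and> balanced k (D ^ (k - 1)) V E}"
proof -
  let ?B = "(2 * real k * (2 ^ (k + 1)) ^ k + 2) * D ^ k * ln n"
  have "{theta k V E | (V :: nat set) E. kgraph k V E \<and> card V = n \<and> balanced k (D ^ (k - 1)) V E}
    \<subseteq> {..nat \<lfloor>?B\<rfloor>}"
  proof (rule subsetI)
    fix t assume "t \<in> {theta k V E | (V :: nat set) E.
      kgraph k V E \<and> card V = n \<and> balanced k (D ^ (k - 1)) V E}"
    then obtain V :: "nat set" and E where VE: "t = theta k V E" "kgraph k V E"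
      "card V = n" "balanced k (D ^ (k - 1)) V E" by auto
    then have "real t \<le> ?B"
      using theta_upper_bound[of k V E D] assms by simp
    then show "t \<in> {..nat \<lfloor>?B\<rfloor>}" unfolding atMost_iff by (rule le_nat_floor)
  qed
  then show ?thesis by (rule finite_subset) simp
qed

lemma deg_image:
  assumes "inj_on h V" "E \<subseteq> Pow V" "S \<subseteq> V"
  shows "deg ((`) h ` E) (h ` S) = deg E S"
proof -
  have sub: "h ` S \<subseteq> h ` e \<longleftrightarrow> S \<subseteq> e" if "e \<in> E" for e
    using inj_on_image_mem_iff[OF assms(1)] that assms(2,3) by blast
  have "{e \<in> (`) h ` E. h ` S \<subseteq> e} = (`) h ` {e \<in> E. S \<subseteq> e}"
    using sub by auto
  moreover have "inj_on ((`) h) {e \<in> E. S \<subseteq> e}"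
    using inj_on_image_Pow[OF assms(1)] by (rule inj_on_subset) (use assms(2) in auto)
  ultimately show ?thesis by (simp add: deg_def card_image)
qed

lemma balanced_embed:
  assumes "0 < D" "2 \<le> k" "finite V" "finite W" "E \<subseteq> nsets V k" "inj_on h V"
    and bal: "balanced k (D ^ (k - 1)) V E"
  shows "balanced k (D ^ (k - 1)) W ((`) h ` E)"
  unfolding balanced_power_iff[OF assms(1,2,4)]
proof (intro ballI)
  fix i S assume i: "i \<in> {1..k}" and S: "S \<in> nsets W i"
  show "real (deg ((`) h ` E) S) \<le> D ^ (k - i)"
  proof (cases "S \<subseteq> h ` V")
    case True
    then obtain T where T: "T \<subseteq> V" "S = h ` T" by (auto simp: subset_image_iff)
    then have "inj_on h T" using assms(6) inj_on_subset by blast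
    then have "card T = i" using S T by (simp add: nsets_def card_image)
    then have "T \<in> nsets V i" using T assms(3) by (auto simp: nsets_def intro: finite_subset)
    then have "real (deg E T) \<le> D ^ (k - i)"
      using bal i unfolding balanced_power_iff[OF assms(1,2,3)] by blast
    moreover have "E \<subseteq> Pow V" using assms(5) by (auto simp: nsets_def)
    ultimately show ?thesis using deg_image[OF assms(6) _ T(1)] T(2) by simp
  next
    case False
    have "\<not> S \<subseteq> e" if "e \<in> (`) h ` E" for e
      using that False assms(5) by (fastforce simp: nsets_def)
    then have "{e \<in> (`) h ` E. S \<subseteq> e} = {}" by blast
    then have "deg ((`) h ` E) S = 0" unfolding deg_def by (simp only: card.empty)
    then show ?thesis using assms(1) by simp
  qed
qed

lemma theta_le_b:
  assumes "2 \<le> k" "1 \<le> D" "2 \<le> n" "kgraph k V E" "balanced k (D ^ (k - 1)) V E" "card V \<le> n"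
  shows "theta k V E \<le> b n (D ^ (k - 1)) k"
proof -
  have V: "finite V" "E \<subseteq> nsets V k" using assms(4) by (auto simp: kgraph_def)
  obtain h where h: "bij_betw h V {0..<card V}"
    using ex_bij_betw_finite_nat[OF V(1)] by blast
  have inj: "inj_on h V" and im: "h ` V \<subseteq> {0..<n}"
    using h assms(6) by (auto simp: bij_betw_def)
  let ?E = "(`) h ` E"
  have "?E \<subseteq> nsets {0..<n} k"
  proof
    fix e assume "e \<in> ?E"
    then obtain f where f: "f \<in> E" "e = h ` f" by blast
    then have "f \<subseteq> V" "finite f" "card f = k" using V by (auto simp: nsets_def)
    then show "e \<in> nsets {0..<n} k"
      using f im inj_on_subset[OF inj, of f] by (auto simp: nsets_def card_image)
  qed
  then have g: "kgraph k {0..<n} ?E" by (simp add: kgraph_def)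
  have "balanced k (D ^ (k - 1)) {0..<n} ?E"
    using assms(1,2) by (intro balanced_embed[OF _ _ V(1) _ V(2) inj assms(5)]) auto
  then have "theta k {0..<n} ?E \<in> {theta k V E | (V :: nat set) E.
      kgraph k V E \<and> card V = n \<and> balanced k (D ^ (k - 1)) V E}"
    using g by (intro CollectI exI[of _ "{0..<n}"] exI[of _ ?E]) simp
  then have "theta k {0..<n} ?E \<le> b n (D ^ (k - 1)) k"
    unfolding b_def by (rule Max_ge[OF finite_theta_values[OF assms(1-3)]])
  moreover have "theta k V E \<le> theta k {0..<n} ?E"
    using theta_embed[OF g _ inj im V(2)] assms(1) by simp
  ultimately show ?thesis by simp
qed

lemma balanced_empty:
  assumes "2 \<le> k" "0 < D" "finite V"
  shows "balanced k (D ^ (k - 1)) V {}"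
  unfolding balanced_power_iff[OF assms(2,1,3)] using assms(2) by (simp add: deg_def)

lemma b_ge_1:
  assumes "2 \<le> k" "1 \<le> D" "2 \<le> n"
  shows "1 \<le> b n (D ^ (k - 1)) k"
proof -
  have g: "kgraph k ({} :: nat set) {}" by (simp add: kgraph_def)
  have "1 \<le> theta k ({} :: nat set) {}" using theta_cover[OF g] assms(1) by auto
  also have "\<dots> \<le> b n (D ^ (k - 1)) k"
    using assms by (intro theta_le_b g balanced_empty) auto
  finally show ?thesis .
qed

lemma b_upper_bound:
  assumes "2 \<le> k" "1 \<le> D" "2 \<le> n"
  shows "real (b n (D ^ (k - 1)) k) \<le> (2 * real k * (2 ^ (k + 1)) ^ k + 2) * D ^ k * ln n"
proof -
  let ?X = "{theta k V E | (V :: nat set) E.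
      kgraph k V E \<and> card V = n \<and> balanced k (D ^ (k - 1)) V E}"
  have "theta k {0..<n} {} \<in> ?X"
    using balanced_empty[of k D "{0..<n}"] assms
    by (intro CollectI exI[of _ "{0..<n}"] exI[of _ "{}"]) (simp add: kgraph_def)
  then have "?X \<noteq> {}" by blast
  then have "b n (D ^ (k - 1)) k \<in> ?X"
    unfolding b_def by (rule Max_in[OF finite_theta_values[OF assms]])
  then obtain V :: "nat set" and E where VE: "b n (D ^ (k - 1)) k = theta k V E" "kgraph k V E"
    "card V = n" "balanced k (D ^ (k - 1)) V E" by auto
  show ?thesis
    unfolding VE(1) using theta_upper_bound[OF VE(2) assms(1,2) VE(4)] VE(3) assms(3) by simp
qed

text \<open>The \<open>fact N ^ (m ^ k)\<close> graphs are encoded by \<open>b\<close> sets each,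
  all of size at most \<open>?s\<close>. Taking logarithms and dividing by \<open>N\<close> gives
  the claim.\<close>

lemma b_counting_bound:
  fixes N k m n :: nat
  assumes "2 \<le> k" "1 \<le> D" "2 \<le> n" "1 \<le> N" "1 \<le> m"
    and m: "2 * real m \<le> D \<or> m = 1" and n: "N * (k * m) \<le> n"
  shows "real m ^ k * ln N \<le> 2 * real k ^ 2 * (1 + ln m) * b n (D ^ (k - 1)) k"
proof -
  let ?V = "verts N k m" and ?s = "N * (k * (k - 1))" and ?b = "b n (D ^ (k - 1)) k"
  let ?G = "\<lambda>\<pi>. transversals N k m \<pi> \<union> cliques N k m"
  let ?I = "{I \<in> Pow ?V. card I \<le> ?s}"
  have bal: "balanced k (D ^ (k - 1)) ?V (?G \<pi>)" if "\<pi> \<in> perms N k m" for \<pi>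
    using assms that by (intro balanced_transversals_cliques) auto
  have G: "?G \<pi> \<subseteq> nsets ?V k" if "\<pi> \<in> perms N k m" for \<pi>
    using transversals_subset[OF assms(1) that] cliques_subset[OF assms(1)] by simp
  have "card (?G ` perms N k m) \<le> card ?I ^ ?b"
  proof (rule card_le_independent_power[where V = ?V and k = k])
    show "theta k ?V E \<le> ?b" if E: "E \<in> ?G ` perms N k m" for E
    proof -
      obtain \<pi> where \<pi>: "\<pi> \<in> perms N k m" "E = ?G \<pi>" using E by blast
      have "kgraph k ?V E" using G[OF \<pi>(1)] \<pi>(2) finite_verts[OF assms(1)] by (simp add: kgraph_def)
      moreover have "card ?V \<le> n" using n card_verts[OF assms(1)] by simp
      ultimately show ?thesis using bal[OF \<pi>(1)] \<pi>(2) by (intro theta_le_b assms(1-3)) simp_all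
    qed
    show "I \<in> ?I" if "E \<in> ?G ` perms N k m" "independent_in ?V E I" for E I
      using that card_independent_le[OF assms(1)] by (auto simp: independent_in_def)
  qed (use G assms(1) in \<open>auto simp: finite_verts\<close>)
  moreover have "card (?G ` perms N k m) = fact N ^ (m ^ k)"
    using card_image[OF inj_on_transversals[OF assms(1)]] card_perms[OF assms(1)] by simp
  ultimately have "real (fact N ^ (m ^ k)) \<le> real (card ?I ^ ?b)" by (simp only: of_nat_le_iff)
  also have "\<dots> \<le> (exp (?s * ln m + N * k)) ^ ?b"
  proof -
    \<comment> \<open>With \<open>x = 1 / m\<close> the second factor is at most
      \<open>exp (card ?V / m) = exp (N * k)\<close>, so the number of small sets is governed by
      \<open>m ^ ?s\<close>.\<close>
    have "real (card ?I) \<le> (1 / (1 / real m)) ^ ?s * (1 + 1 / real m) ^ card ?V"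
      using assms by (intro card_bounded_subsets_le) (auto simp: finite_verts)
    also have "\<dots> \<le> exp (ln m) ^ ?s * exp (1 / m) ^ card ?V"
      using assms(5) exp_ge_add_one_self[of "1 / real m"]
      by (intro mult_mono power_mono) (auto simp: add_pos_pos)
    also have "\<dots> = exp (?s * ln m + card ?V * (1 / m))"
      by (simp only: exp_add exp_of_nat_mult)
    also have "card ?V * (1 / m) = N * k"
      using assms(5) by (simp add: card_verts[OF assms(1)])
    finally show ?thesis by (simp add: power_mono)
  qed
  finally have "real (fact N) ^ (m ^ k) \<le> exp (?b * (?s * ln m + N * k))"
    by (simp only: exp_of_nat_mult of_nat_power)
  then have "ln (real (fact N) ^ (m ^ k)) \<le> ln (exp (?b * (?s * ln m + N * k)))"
    by (intro ln_mono) auto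
  then have main: "real m ^ k * ln (real (fact N)) \<le> ?b * (?s * ln m + N * k)"
    by (simp add: ln_realpow)
  have "real N ^ N \<le> real (fact N) ^ 2"
    using power_le_fact_power2[of N] by (metis of_nat_le_iff of_nat_power)
  then have "ln (real N ^ N) \<le> ln (real (fact N) ^ 2)"
    using assms(4) by (intro ln_mono) auto
  then have "N * ln N \<le> 2 * ln (real (fact N))"
    using assms(4) by (simp add: ln_realpow)
  then have "real m ^ k * (N * ln N) \<le> real m ^ k * (2 * ln (real (fact N)))"
    by (intro mult_left_mono) auto
  also have "\<dots> \<le> 2 * (?b * (?s * ln m + N * k))" using main by simp
  also have "\<dots> \<le> 2 * (?b * (N * (real k ^ 2 * ln m) + N * (real k ^ 2)))"
  proof -
    have "real ?s \<le> N * real k ^ 2"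
      by (simp add: power2_eq_square mult_left_mono)
    then have "?s * ln m \<le> N * real k ^ 2 * ln m"
      using assms(5) by (intro mult_right_mono) auto
    moreover have "real k * 1 \<le> real k * real k" using assms(1) by (intro mult_left_mono) auto
    then have "real N * k \<le> N * real k ^ 2"
      by (simp add: power2_eq_square mult_left_mono)
    ultimately have "?s * ln m + N * k \<le> N * (real k ^ 2 * ln m) + N * (real k ^ 2)" by simp
    then show ?thesis by (intro mult_left_mono) auto
  qed
  also have "\<dots> = N * (2 * real k ^ 2 * (1 + ln m) * ?b)" by (simp add: algebra_simps)
  finally have "N * (real m ^ k * ln N) \<le> N * (2 * real k ^ 2 * (1 + ln m) * ?b)"
    by (simp add: mult_ac)
  then show ?thesis using assms(4) by (simp only: mult_le_cancel_left_pos of_nat_0_less_iff)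
qed

section \<open>Choice of \<open>m\<close> and \<open>N\<close>\<close>

lemma floor_half_le:
  assumes "1 \<le> (x::real)"
  shows "x / 2 \<le> real (nat \<lfloor>x\<rfloor>)"
proof -
  have "1 \<le> \<lfloor>x\<rfloor>" using assms by simp
  then have "real (nat \<lfloor>x\<rfloor>) = of_int \<lfloor>x\<rfloor>" "1 \<le> real_of_int \<lfloor>x\<rfloor>" by simp_all
  then show ?thesis using real_of_int_floor_add_one_gt[of x] by linarith
qed

lemma real_div_ge:
  assumes "0 < q"
  shows "real n / real q - 1 \<le> real (n div q)"
proof -
  have "n < (n div q + 1) * q" using mod_less_divisor[OF assms, of n] div_mult_mod_eq[of n q]
    unfolding distrib_right by linarith
  then have "real n < real ((n div q + 1) * q)" by (simp only: of_nat_less_iff)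
  then have "real n / real q < real (n div q + 1)" using assms by (simp add: pos_divide_less_eq distrib_right)
  then show ?thesis by simp
qed

lemma b_lower_bound_large:
  assumes "2 \<le> k" "2 * real k \<le> D" "D < real n"
  shows "D ^ k * ln (n / D) / ((4 * real k) ^ k * (4 * real k ^ 2) * ln D)
    \<le> real (b n (D ^ (k - 1)) k)"
proof -
  have D4: "4 \<le> D" using assms by linarith
  \<comment> \<open>Balance only asks for \<open>2 * m \<le> D\<close>. The extra factor
    \<open>k\<close> gives \<open>k * m \<le> D / 2\<close>, which leaves room for
    \<open>N \<ge> n / D\<close> after rounding.\<close>
  define m where "m = nat \<lfloor>D / (2 * k)\<rfloor>"
  define N where "N = n div (k * m)"
  have D1: "1 \<le> D / (2 * k)" using assms by simp
  have m_ge: "D / (4 * k) \<le> m"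
    using floor_half_le[OF D1] by (simp add: m_def)
  have m_le: "m \<le> D / (2 * k)" using D1 by (simp add: m_def)
  have m1: "1 \<le> m" using D1 by (simp add: m_def le_nat_floor)
  have "2 * real k * m \<le> D" using m_le assms(1) by (simp add: field_simps)
  have "2 * real m \<le> 2 * real k * real m" using assms(1) by (intro mult_right_mono) auto
  then have m2: "2 * real m \<le> D" using \<open>2 * real k * m \<le> D\<close> by linarith
  have "n / D \<le> N"
  proof -
    have "2 * n / D \<le> n / (k * m)"
      using mult_right_mono[OF \<open>2 * real k * m \<le> D\<close>, of n] m1 assms(1) D4
      by (simp add: field_simps)
    \<comment> \<open>Pays for the 1 lost in the integer division:
      \<open>2 * n / D - 1 \<ge> n / D\<close>.\<close>
    moreover have "1 \<le> n / D" using assms D4 by simp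
    ultimately show ?thesis
      using real_div_ge[of "k * m" n] m1 assms(1) by (simp add: N_def)
  qed
  have "1 < n / D" using assms D4 by simp
  then have "1 \<le> N" using \<open>n / D \<le> N\<close> by linarith
  have ln1: "1 \<le> ln D"
  proof -
    have "2 * ln 2 = ln (2 * 2 :: real)" by (subst ln_mult) auto
    also have "\<dots> \<le> ln D" using D4 by (intro ln_mono) auto
    finally show ?thesis using half_le_ln_2 by linarith
  qed
  have "ln m \<le> ln D" using m2 m1 by (intro ln_mono) auto
  have "(D / (4 * k)) ^ k * ln (n / D) \<le> real m ^ k * ln N"
  proof (intro mult_mono power_mono ln_mono)
    show "D / (4 * k) \<le> m" by (rule m_ge)
    show "n / D \<le> N" by fact
    show "0 \<le> ln (n / D)" using \<open>1 < n / D\<close> by simp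
  qed (use \<open>1 < n / D\<close> \<open>1 \<le> N\<close> D4 in auto)
  also have "\<dots> \<le> 2 * real k ^ 2 * (1 + ln m) * b n (D ^ (k - 1)) k"
  proof (rule b_counting_bound)
    show "N * (k * m) \<le> n" by (simp add: N_def)
    show "2 \<le> n" using assms D4 by linarith
  qed (use assms D4 m1 m2 \<open>1 \<le> N\<close> in auto)
  also have "\<dots> \<le> 2 * real k ^ 2 * (2 * ln D) * b n (D ^ (k - 1)) k"
    using \<open>ln m \<le> ln D\<close> ln1 by (intro mult_right_mono mult_left_mono) auto
  finally have "D ^ k * ln (n / D) / (4 * real k) ^ k \<le> real (b n (D ^ (k - 1)) k) * (4 * real k ^ 2 * ln D)"
    by (simp add: power_divide mult_ac)
  moreover have "0 < 4 * real k ^ 2 * ln D" using ln1 assms(1) by simp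
  ultimately have "D ^ k * ln (n / D) / (4 * real k) ^ k / (4 * real k ^ 2 * ln D) \<le> real (b n (D ^ (k - 1)) k)"
    by (simp only: pos_divide_le_eq)
  then show ?thesis by (simp only: divide_divide_eq_left mult.assoc)
qed

text \<open>The construction with \<open>m = 1\<close> works for every \<open>D \<ge> 1\<close>. If
  \<open>n \<ge> 4 * k ^ 2\<close>, then \<open>N = n div k\<close> satisfies
  \<open>N ^ 2 \<ge> n\<close>, so \<open>ln N\<close> is at least half of \<open>ln n\<close>. For
  smaller \<open>n\<close> the bound \<open>b \<ge> 1\<close> suffices.\<close>

lemma b_lower_bound_small:
  assumes "2 \<le> k" "1 \<le> D" "2 \<le> n"
  shows "ln n \<le> 4 * real k ^ 2 * b n (D ^ (k - 1)) k"
proof (cases "4 * k ^ 2 \<le> n")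
  case True
  let ?N = "n div k"
  have n4: "4 * real k ^ 2 \<le> n" using True by (metis of_nat_le_iff of_nat_mult of_nat_numeral of_nat_power)
  have "2 * k \<le> 4 * k ^ 2" using assms(1) by (simp add: power2_eq_square)
  then have "2 * k \<le> n" using True by simp
  then have "2 * real k \<le> n" by linarith
  then have "1 \<le> n / (2 * k)" using assms(1) by simp
  then have N: "n / (2 * k) \<le> ?N"
  proof -
    have "real n / k = 2 * (n / (2 * k))" by simp
    then show ?thesis using real_div_ge[of k n] assms(1) \<open>1 \<le> n / (2 * k)\<close> by linarith
  qed
  have "1 \<le> ?N" using N \<open>1 \<le> n / (2 * k)\<close> by linarith
  have "real n = real n * (4 * real k ^ 2) / (4 * real k ^ 2)" using assms(1) by simp
  also have "\<dots> \<le> real n * real n / (4 * real k ^ 2)"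
    using n4 by (intro divide_right_mono mult_left_mono) auto
  also have "\<dots> = (n / (2 * k)) ^ 2" by (simp add: power2_eq_square)
  also have "\<dots> \<le> real ?N ^ 2" using N by (intro power_mono) auto
  finally have "ln n \<le> ln (real ?N ^ 2)" using assms(3) by (intro ln_mono) auto
  then have "ln n \<le> 2 * ln ?N" using \<open>1 \<le> ?N\<close> by (simp add: ln_realpow)
  moreover have "real 1 ^ k * ln ?N \<le> 2 * real k ^ 2 * (1 + ln (real 1)) * b n (D ^ (k - 1)) k"
    by (rule b_counting_bound) (use assms \<open>1 \<le> ?N\<close> in auto)
  ultimately show ?thesis by simp
next
  case False
  have "ln n \<le> real n" using ln_le_minus_one[of "real n"] assms(3) by simp
  also have "real n \<le> real (4 * k ^ 2)" using False by (simp only: of_nat_le_iff)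
  also have "\<dots> = 4 * real k ^ 2 * 1" by simp
  also have "\<dots> \<le> 4 * real k ^ 2 * b n (D ^ (k - 1)) k"
    using b_ge_1[OF assms] by (intro mult_left_mono) auto
  finally show ?thesis .
qed

text \<open>For \<open>D \<ge> n\<close> the left side is not positive, and for
  \<open>2 * k \<le> D < n\<close> the large case applies. For \<open>D < 2 * k\<close> the factor
  \<open>D ^ k / ln D\<close> is bounded in terms of \<open>k\<close>, so a bound of order
  \<open>ln n\<close> suffices. The constant \<open>8 * k ^ 3 = 2 * k * (4 * k ^ 2)\<close> is
  fitted to this last case.\<close>

lemma b_lower_bound:
  assumes "2 \<le> k" "2 \<le> D ^ (k - 1)" "1 \<le> D" "2 \<le> n"
  shows "1 / ((4 * real k) ^ k * (8 * real k ^ 3)) * D ^ k / ln D * ln (n / D)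
    \<le> real (b n (D ^ (k - 1)) k)"
proof -
  have "D \<noteq> 1" using assms(2) by auto
  then have "1 < D" using assms(3) by simp
  then have lnD: "0 < ln D" by simp
  let ?C = "(4 * real k) ^ k * (8 * real k ^ 3)"
  have C: "0 < ?C" using assms(1) by simp
  show ?thesis
  proof (cases "D < n")
    case False
    then have "ln (n / D) \<le> 0" using \<open>1 < D\<close> assms(4) by simp
    then have "1 / ?C * D ^ k / ln D * ln (n / D) \<le> 0"
      using C lnD \<open>1 < D\<close> by (intro mult_nonneg_nonpos) auto
    then show ?thesis by linarith
  next
    case True
    have lnn: "0 \<le> ln (n / D)" using True \<open>1 < D\<close> by simp
    show ?thesis
    proof (cases "2 * real k \<le> D")
      case large: True
      have "real k ^ 2 * 4 \<le> real k ^ 2 * (8 * k)" using assms(1) by (intro mult_left_mono) auto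
      then have "(4 * real k) ^ k * (4 * real k ^ 2) * ln D \<le> ?C * ln D"
        using lnD by (intro mult_right_mono mult_left_mono) (auto simp: eval_nat_numeral)
      then have "D ^ k * ln (n / D) / (?C * ln D)
          \<le> D ^ k * ln (n / D) / ((4 * real k) ^ k * (4 * real k ^ 2) * ln D)"
        using lnn lnD \<open>1 < D\<close> assms(1) by (intro divide_left_mono mult_pos_pos mult_nonneg_nonneg) auto
      also have "\<dots> \<le> real (b n (D ^ (k - 1)) k)"
        by (rule b_lower_bound_large[OF assms(1) large True])
      finally show ?thesis by (simp add: mult_ac)
    next
      case False
      \<comment> \<open>The assumption \<open>2 \<le> D ^ (k - 1)\<close> keeps \<open>ln D\<close>
        away from 0.\<close>
      have "1 / 2 \<le> ln (D ^ (k - 1))"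
        using half_le_ln_2 ln_mono[OF assms(2)] by simp
      also have "\<dots> = real (k - 1) * ln D" using \<open>1 < D\<close> by (simp add: ln_realpow)
      also have "\<dots> \<le> real k * ln D" using lnD by (intro mult_right_mono) auto
      finally have inv: "1 / ln D \<le> 2 * real k" using lnD by (simp add: field_simps)
      have "1 / ?C * D ^ k / ln D * ln (n / D) = 1 / ?C * (D ^ k * (1 / ln D) * ln (n / D))" by simp
      also have "\<dots> \<le> 1 / ?C * ((4 * real k) ^ k * (2 * real k) * ln n)"
      proof (intro mult_left_mono mult_mono power_mono inv)
        show "ln (n / D) \<le> ln n" using \<open>1 < D\<close> assms(4) by (intro ln_mono) (auto simp: divide_le_eq)
      qed (use False C lnD lnn \<open>1 < D\<close> in auto)
      also have "\<dots> \<le> 1 / ?C * ((4 * real k) ^ k * (2 * real k) * (4 * real k ^ 2 * b n (D ^ (k - 1)) k))"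
        using b_lower_bound_small[OF assms(1,3,4)] C by (intro mult_left_mono) auto
      also have "\<dots> = real (b n (D ^ (k - 1)) k)"
        using assms(1) by (simp add: field_simps eval_nat_numeral)
      finally show ?thesis .
    qed
  qed
qed

section \<open>Both bounds in terms of \<open>d\<close>\<close>

theorem theorem2p1:
  fixes k :: nat
  assumes "k \<ge> 2"
  shows "\<exists>c1 c2 :: real. c1 > 0 \<and> c2 > 0 \<and>
    (\<forall>(n :: nat) (d :: real). n \<ge> 2 \<longrightarrow> d \<ge> 2 \<longrightarrow>
       c1 * d powr (real k / (real k - 1)) / ln d * ln (real n ^ (k - 1) / d) \<le> real (b n d k) \<and>
       real (b n d k) \<le> c2 * d powr (real k / (real k - 1)) * ln (real n))"
proof (intro exI conjI allI impI)
  show "1 / ((4 * real k) ^ k * (8 * real k ^ 3)) > 0" using assms by simp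
  show "2 * real k * (2 ^ (k + 1)) ^ k + 2 > 0" by (simp add: add_nonneg_pos)
  fix n :: nat and d :: real assume n: "n \<ge> 2" and d: "d \<ge> 2"
  define D where "D = d powr (1 / real (k - 1))"
  have D1: "1 \<le> D" using d assms by (simp add: D_def ge_one_powr_ge_zero)
  have dD: "d = D ^ (k - 1)"
    using d assms by (simp add: D_def powr_realpow[symmetric] powr_powr)
  have powr: "d powr (real k / (real k - 1)) = D ^ k"
    using powr_power_quotient[of D k 0] D1 assms by (simp add: dD)
  have "D \<noteq> 1" using d dD by auto
  then have "1 < D" using D1 by simp
  have "ln (real n ^ (k - 1) / d) = ln ((n / D) ^ (k - 1))"
    by (simp add: dD power_divide)
  also have "\<dots> = real (k - 1) * ln (n / D)" using \<open>1 < D\<close> n by (simp add: ln_realpow)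
  finally have ln_quot: "ln (real n ^ (k - 1) / d) = real (k - 1) * ln (n / D)" .
  have ln_d: "ln d = real (k - 1) * ln D" using \<open>1 < D\<close> by (simp add: dD ln_realpow)
  \<comment> \<open>The factor \<open>k - 1\<close> appears in both logarithms and cancels, so the
    constants carry over unchanged.\<close>
  have "x / ln d * ln (real n ^ (k - 1) / d) = x / ln D * ln (n / D)" for x
    unfolding ln_quot ln_d using assms \<open>1 < D\<close> by simp
  note this[of "1 / ((4 * real k) ^ k * (8 * real k ^ 3)) * D ^ k"]
  then show "1 / ((4 * real k) ^ k * (8 * real k ^ 3)) * d powr (real k / (real k - 1)) / ln d
      * ln (real n ^ (k - 1) / d) \<le> real (b n d k)"
    unfolding powr using b_lower_bound[OF assms d[unfolded dD] D1 n] by (simp only: dD)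
  show "real (b n d k) \<le> (2 * real k * (2 ^ (k + 1)) ^ k + 2) * d powr (real k / (real k - 1)) * ln n"
    unfolding powr using b_upper_bound[OF assms D1 n] by (simp add: dD)
qed

end
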